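(* Let $\Bbbk$ be a field and $\Bbbk[\mathbf{x}]=\Bbbk[x_1,\dots,x_n]$. Let $\Delta:\Bbbk[\mathbf{x}]\to\Bbbk[\mathbf{x}]\otimes_{\Bbbk}\Bbbk[\mathbf{x}]$ be the $\Bbbk$-algebra homomorphism defined by $\Delta(x_i)=x_i\otimes x_i$. The following are equivalent for an ideal $I\subseteq\Bbbk[\mathbf{x}]$. (1) $I$ is unital. (2) $I$ is a coideal with respect to $\Delta$; that is, $\Delta(I)\subseteq \Bbbk[\mathbf{x}]\otimes_{\Bbbk} I + I\otimes_{\Bbbk}\Bbbk[\mathbf{x}]$.
   Context: An ideal in $\Bbbk[\mathbf{x}]$ is unital if it is generated by monomials and differences of monomials, i.e. by elements of the form $\mathbf{x}^{\mathbf{a}}-\lambda\mathbf{x}^{\mathbf{b}}$ with $\mathbf{a},\mathbf{b}\in\mathbb{N}^n$ and $\lambda\in\{0,1\}$. *)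

theory Defs
  imports Complex_Main "HOL-Library.Poly_Mapping" "HOL-Library.Product_Plus" "HOL-Library.Set_Algebras"
begin

section \<open>Polynomials\<close>

text \<open>
  Exponent vectors are finitely supported maps \<open>'n \<Rightarrow>\<^sub>0 nat\<close>; for a finite type \<open>'n\<close> of indices these
  are all maps. Addition of exponent vectors is multiplication of monomials, and the ring structure
  that \<open>Poly_Mapping\<close> puts on \<open>('n \<Rightarrow>\<^sub>0 nat) \<Rightarrow>\<^sub>0 'k\<close> is that of the polynomial ring.
\<close>

type_synonym ('n, 'k) mpoly = "('n \<Rightarrow>\<^sub>0 nat) \<Rightarrow>\<^sub>0 'k"

definition monom :: "'m \<Rightarrow> 'm \<Rightarrow>\<^sub>0 'k::field"
  where "monom a = Poly_Mapping.single a 1"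

definition var :: "'n \<Rightarrow> ('n, 'k::field) mpoly"
  where "var i = monom (Poly_Mapping.single i 1)"

text \<open>
  The vector space structure is needed for two kinds of finitely supported functions: for
  polynomials, and for the free vector space from which the tensor product is built.
\<close>

definition scale :: "'k::field \<Rightarrow> ('a \<Rightarrow>\<^sub>0 'k) \<Rightarrow> ('a \<Rightarrow>\<^sub>0 'k)"
  where "scale c p = Poly_Mapping.map ((*) c) p"

lemma lookup_scale [simp]: "Poly_Mapping.lookup (scale c p) x = c * Poly_Mapping.lookup p x"
  by (simp add: scale_def Poly_Mapping.map.rep_eq when_def)

global_interpretation fin_fun: vector_space "scale :: 'k::field \<Rightarrow> ('a \<Rightarrow>\<^sub>0 'k) \<Rightarrow> ('a \<Rightarrow>\<^sub>0 'k)"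
  by unfold_locales (auto intro!: poly_mapping_eqI simp: lookup_add algebra_simps)

lemma scale_single [simp]: "scale c (Poly_Mapping.single x d) = Poly_Mapping.single x (c * d)"
  by (auto intro!: poly_mapping_eqI simp: lookup_single when_def)

lemma scale_eq_mult: "scale c p = Poly_Mapping.single 0 c * p"
  for p :: "'a::monoid_add \<Rightarrow>\<^sub>0 'k::field"
  by (simp add: scale_def mult_map_scale_conv_mult)

lemma scale_mult_left: "scale c p * q = scale c (p * q)"
  for p q :: "'a::comm_monoid_add \<Rightarrow>\<^sub>0 'k::field"
  by (simp add: scale_eq_mult mult.assoc)

lemma scale_mult_right: "p * scale c q = scale c (p * q)"
  for p q :: "'a::comm_monoid_add \<Rightarrow>\<^sub>0 'k::field"
  by (simp add: scale_eq_mult ac_simps)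

lemma sum_single_lookup: "(\<Sum>x\<in>Poly_Mapping.keys p. Poly_Mapping.single x (Poly_Mapping.lookup p x)) = p"
proof (rule poly_mapping_eqI)
  fix y
  show "Poly_Mapping.lookup (\<Sum>x\<in>Poly_Mapping.keys p. Poly_Mapping.single x (Poly_Mapping.lookup p x)) y = Poly_Mapping.lookup p y"
    by (cases "y \<in> Poly_Mapping.keys p")
      (auto simp: lookup_sum lookup_single when_def sum.delta in_keys_iff cong: if_cong)
qed

lemma sum_scale_monom: "(\<Sum>x\<in>Poly_Mapping.keys p. scale (Poly_Mapping.lookup p x) (monom x)) = p"
  by (simp add: monom_def sum_single_lookup)

definition (in vector_space) lin_extend :: "('x \<Rightarrow> 'b) \<Rightarrow> ('x \<Rightarrow>\<^sub>0 'a) \<Rightarrow> 'b"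
  where "lin_extend g p = (\<Sum>x\<in>Poly_Mapping.keys p. Poly_Mapping.lookup p x *s g x)"

context vector_space
begin

lemma lin_extend_superset:
  assumes "finite X" "Poly_Mapping.keys p \<subseteq> X"
  shows "lin_extend g p = (\<Sum>x\<in>X. Poly_Mapping.lookup p x *s g x)"
  unfolding lin_extend_def using assms by (intro sum.mono_neutral_left) (auto simp: in_keys_iff)

lemma lin_extend_add: "lin_extend g (p + q) = lin_extend g p + lin_extend g q"
  using keys_add[of p q]
  by (simp add: lin_extend_superset[of "Poly_Mapping.keys p \<union> Poly_Mapping.keys q"] lookup_add scale_left_distrib sum.distrib)

lemma lin_extend_scale: "lin_extend g (Defs.scale c p) = c *s lin_extend g p"
  by (subst (1 2) lin_extend_superset[of "Poly_Mapping.keys p"]) (auto simp: in_keys_iff scale_sum_right)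

lemma lin_extend_single [simp]: "lin_extend g (Poly_Mapping.single x c) = c *s g x"
  by (subst lin_extend_superset[of "{x}"]) auto

lemma lin_extend_diff: "lin_extend g (p - q) = lin_extend g p - lin_extend g q"
  using lin_extend_add[of g "p - q" q] by (simp add: algebra_simps)

lemma lin_extend_zero [simp]: "lin_extend g 0 = 0"
  by (simp add: lin_extend_def)

end


section \<open>Ideals\<close>

lemma module_times: "module ((*) :: 'a::comm_ring_1 \<Rightarrow> 'a \<Rightarrow> 'a)"
  by unfold_locales (simp_all add: algebra_simps)

definition is_ideal :: "'a::comm_ring_1 set \<Rightarrow> bool"
  where "is_ideal I \<longleftrightarrow> module.subspace (*) I"

definition ideal_generated :: "'a::comm_ring_1 set \<Rightarrow> 'a set"
  where "ideal_generated G = module.span (*) G"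

lemma is_ideal_iff:
  "is_ideal I \<longleftrightarrow> 0 \<in> I \<and> (\<forall>x\<in>I. \<forall>y\<in>I. x + y \<in> I) \<and> (\<forall>r. \<forall>x\<in>I. r * x \<in> I)"
  by (auto simp: is_ideal_def module.subspace_def[OF module_times])

lemma ideal_generated_eq: "ideal_generated G = \<Inter>{I. is_ideal I \<and> G \<subseteq> I}"
proof -
  interpret module "(*) :: 'a \<Rightarrow> 'a \<Rightarrow> 'a" by (fact module_times)
  show ?thesis
    unfolding is_ideal_def ideal_generated_def
    by (auto dest: span_minimal intro: span_superset subspace_span span_base)
qed

definition unital :: "('n, 'k::field) mpoly set \<Rightarrow> bool"
  where "unital I \<longleftrightarrow>
    (\<exists>G \<subseteq> {monom a - scale c (monom b) | a b c. c \<in> {0, 1}}. I = ideal_generated G)"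


section \<open>Tensor products\<close>

text \<open>
  The tensor product of two algebras \<open>A = ('a \<Rightarrow>\<^sub>0 'k)\<close> and \<open>B = ('b \<Rightarrow>\<^sub>0 'k)\<close> over the field \<open>'k\<close> is
  the free vector space on the set \<open>A \<times> B\<close> modulo the span of the bilinearity relations.

  The type \<open>'r mult_monoid\<close> is a copy of \<open>'r\<close> whose addition is the multiplication of \<open>'r\<close>. With it,
  the convolution product of \<open>Poly_Mapping\<close> on the free vector space is the bilinear extension of
  \<open>(p, q) * (p', q') = (p * p', q * q')\<close>, which induces the product of the tensor product.
\<close>

datatype 'r mult_monoid = Mult 'r

instantiation mult_monoid :: (comm_monoid_mult) comm_monoid_add
begin

definition zero_mult_monoid :: "'a mult_monoid"
  where "0 = Mult 1"

fun plus_mult_monoid :: "'a mult_monoid \<Rightarrow> 'a mult_monoid \<Rightarrow> 'a mult_monoid"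
  where "Mult p + Mult q = Mult (p * q)"

instance
proof
  fix x y z :: "'a mult_monoid"
  show "x + y + z = x + (y + z)"
    by (cases x; cases y; cases z) (simp add: mult.assoc)
  show "x + y = y + x"
    by (cases x; cases y) (simp add: mult.commute)
  show "0 + x = x"
    by (cases x) (simp add: zero_mult_monoid_def)
qed

end

type_synonym ('a, 'b, 'k) free_pairs =
  "(('a \<Rightarrow>\<^sub>0 'k) mult_monoid \<times> ('b \<Rightarrow>\<^sub>0 'k) mult_monoid) \<Rightarrow>\<^sub>0 'k"

definition pair :: "('a \<Rightarrow>\<^sub>0 'k) \<Rightarrow> ('b \<Rightarrow>\<^sub>0 'k) \<Rightarrow> ('a, 'b, 'k::field) free_pairs"
  where "pair p q = monom (Mult p, Mult q)"

definition bilin_rels :: "('a, 'b, 'k::field) free_pairs set"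
  where "bilin_rels =
      {pair (p + p') q - pair p q - pair p' q | p p' q. True}
    \<union> {pair p (q + q') - pair p q - pair p q' | p q q'. True}
    \<union> {pair (scale c p) q - scale c (pair p q) | c p q. True}
    \<union> {pair p (scale c q) - scale c (pair p q) | c p q. True}"

definition bilin_null :: "('a, 'b, 'k::field) free_pairs set"
  where "bilin_null = fin_fun.span bilin_rels"

quotient_type (overloaded) ('a, 'b, 'k) tensor =
  "('a, 'b, 'k::field) free_pairs" / "\<lambda>s t. s - t \<in> bilin_null"
proof (intro equivpI reflpI sympI transpI)
  fix s t u :: "('a, 'b, 'k) free_pairs"
  show "s - s \<in> bilin_null"
    by (simp add: bilin_null_def fin_fun.span_zero)
  show "t - s \<in> bilin_null" if "s - t \<in> bilin_null"
    using fin_fun.span_neg[OF that[unfolded bilin_null_def]] by (simp add: bilin_null_def)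
  show "s - u \<in> bilin_null" if "s - t \<in> bilin_null" "t - u \<in> bilin_null"
    using fin_fun.span_add[OF that[unfolded bilin_null_def]] by (simp add: bilin_null_def)
qed

lift_definition tensor_of ::
  "('a \<Rightarrow>\<^sub>0 'k) \<Rightarrow> ('b \<Rightarrow>\<^sub>0 'k) \<Rightarrow> ('a, 'b, 'k::field) tensor" (infixl \<open>\<otimes>\<close> 70)
  is pair .

lift_definition tensor_scale ::
  "'k::field \<Rightarrow> ('a, 'b, 'k) tensor \<Rightarrow> ('a, 'b, 'k) tensor" is scale
  by (simp add: bilin_null_def fin_fun.span_scale flip: fin_fun.scale_right_diff_distrib)

instantiation tensor :: (type, type, field) ab_group_add
begin

lift_definition zero_tensor :: "('a, 'b, 'c) tensor" is 0 .

lift_definition plus_tensor ::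
  "('a, 'b, 'c) tensor \<Rightarrow> ('a, 'b, 'c) tensor \<Rightarrow> ('a, 'b, 'c) tensor" is "(+)"
  by (simp add: bilin_null_def add_diff_add fin_fun.span_add)

lift_definition uminus_tensor :: "('a, 'b, 'c) tensor \<Rightarrow> ('a, 'b, 'c) tensor" is uminus
  by (simp only: bilin_null_def minus_diff_minus fin_fun.span_neg)

lift_definition minus_tensor ::
  "('a, 'b, 'c) tensor \<Rightarrow> ('a, 'b, 'c) tensor \<Rightarrow> ('a, 'b, 'c) tensor" is "(-)"
proof -
  fix s s' t t' :: "('a, 'b, 'c) free_pairs"
  assume "s - s' \<in> bilin_null" "t - t' \<in> bilin_null"
  then have "(s - s') - (t - t') \<in> bilin_null"
    unfolding bilin_null_def by (rule fin_fun.span_diff)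
  then show "s - t - (s' - t') \<in> bilin_null"
    by (simp add: algebra_simps)
qed

instance
  by standard (transfer; simp add: bilin_null_def fin_fun.span_zero algebra_simps)+

end

global_interpretation tensor: vector_space
  "tensor_scale :: 'k::field \<Rightarrow> ('a, 'b, 'k) tensor \<Rightarrow> ('a, 'b, 'k) tensor"
  by unfold_locales (transfer; simp add: bilin_null_def fin_fun.span_zero fin_fun.scale_right_distrib
      fin_fun.scale_left_distrib)+

lemma bilin_null_base: "r \<in> bilin_rels \<Longrightarrow> r \<in> bilin_null"
  by (simp add: bilin_null_def fin_fun.span_base)

lemma tensor_of_add_left: "(p + p') \<otimes> q = p \<otimes> q + p' \<otimes> q"
  by transfer (intro bilin_null_base, unfold bilin_rels_def diff_diff_eq[symmetric], blast)

lemma tensor_of_add_right: "p \<otimes> (q + q') = p \<otimes> q + p \<otimes> q'"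
  by transfer (intro bilin_null_base, unfold bilin_rels_def diff_diff_eq[symmetric], blast)

lemma tensor_of_scale_left: "scale c p \<otimes> q = tensor_scale c (p \<otimes> q)"
  by transfer (intro bilin_null_base, unfold bilin_rels_def, blast)

lemma tensor_of_scale_right: "p \<otimes> scale c q = tensor_scale c (p \<otimes> q)"
  by transfer (intro bilin_null_base, unfold bilin_rels_def, blast)

lemma pair_mult: "pair p q * pair p' q' = pair (p * p') (q * q')"
  for p p' :: "'a::comm_monoid_add \<Rightarrow>\<^sub>0 'k::field" and q q' :: "'b::comm_monoid_add \<Rightarrow>\<^sub>0 'k"
  by (simp add: pair_def monom_def mult_single)

lemma one_free_pairs: "1 = (pair 1 1 :: ('a::comm_monoid_add, 'b::comm_monoid_add, 'k::field) free_pairs)"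
proof -
  have "(0 :: ('a \<Rightarrow>\<^sub>0 'k) mult_monoid \<times> ('b \<Rightarrow>\<^sub>0 'k) mult_monoid) = (Mult 1, Mult 1)"
    by (simp only: zero_prod_def zero_mult_monoid_def)
  then show ?thesis by (metis pair_def monom_def single_one)
qed

lemma pair_mult_bilin_rels:
  fixes r :: "('a::comm_monoid_add, 'b::comm_monoid_add, 'k::field) free_pairs"
  assumes "r \<in> bilin_rels"
  shows "pair a b * r \<in> bilin_rels"
  using assms unfolding bilin_rels_def
  by (fastforce simp: right_diff_distrib pair_mult distrib_left scale_mult_right)

lemma mult_bilin_null:
  fixes s t :: "('a::comm_monoid_add, 'b::comm_monoid_add, 'k::field) free_pairs"
  assumes "t \<in> bilin_null"
  shows "s * t \<in> bilin_null"
proof -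
  have base: "monom x * t \<in> bilin_null"
    for x :: "('a \<Rightarrow>\<^sub>0 'k) mult_monoid \<times> ('b \<Rightarrow>\<^sub>0 'k) mult_monoid"
  proof -
    obtain a b where x: "x = (Mult a, Mult b)"
      by (metis mult_monoid.exhaust surj_pair)
    have "pair a b * t \<in> bilin_null"
      using assms unfolding bilin_null_def
    proof (induction rule: fin_fun.span_induct_alt)
      case base
      show ?case by (simp add: fin_fun.span_zero)
    next
      case (step c r t)
      then show ?case
        by (simp add: distrib_left scale_mult_right fin_fun.span_add fin_fun.span_scale
            fin_fun.span_base pair_mult_bilin_rels)
    qed
    then show ?thesis by (simp add: x pair_def)
  qed
  have "(\<Sum>x\<in>Poly_Mapping.keys s. scale (Poly_Mapping.lookup s x) (monom x)) * t \<in> bilin_null"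
    using base unfolding sum_distrib_right scale_mult_left bilin_null_def
    by (intro fin_fun.span_sum fin_fun.span_scale) auto
  then show ?thesis by (simp add: sum_scale_monom)
qed

instantiation tensor :: (comm_monoid_add, comm_monoid_add, field) comm_ring_1
begin

lift_definition one_tensor :: "('a, 'b, 'c) tensor" is 1 .

lift_definition times_tensor ::
  "('a, 'b, 'c) tensor \<Rightarrow> ('a, 'b, 'c) tensor \<Rightarrow> ('a, 'b, 'c) tensor" is "(*)"
proof -
  fix s s' t t' :: "('a, 'b, 'c) free_pairs"
  assume "s - s' \<in> bilin_null" "t - t' \<in> bilin_null"
  then have "t * (s - s') + s' * (t - t') \<in> bilin_null"
    using mult_bilin_null unfolding bilin_null_def by (blast intro: fin_fun.span_add)
  then show "s * t - s' * t' \<in> bilin_null"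
    by (simp add: algebra_simps)
qed

instance
proof
  fix r s t :: "('a, 'b, 'c) tensor"
  show "r * s * t = r * (s * t)"
    by transfer (simp add: bilin_null_def fin_fun.span_zero mult.assoc)
  show "r * s = s * r"
    by transfer (simp add: bilin_null_def fin_fun.span_zero mult.commute)
  show "1 * r = r"
    by transfer (simp add: bilin_null_def fin_fun.span_zero)
  show "(r + s) * t = r * t + s * t"
    by transfer (simp add: bilin_null_def fin_fun.span_zero distrib_right)
  show "(0 :: ('a, 'b, 'c) tensor) \<noteq> 1"
  proof transfer
    interpret k: vector_space "(*) :: 'c \<Rightarrow> 'c \<Rightarrow> 'c"
      by unfold_locales (simp_all add: algebra_simps)
    define g :: "('a \<Rightarrow>\<^sub>0 'c) mult_monoid \<times> ('b \<Rightarrow>\<^sub>0 'c) mult_monoid \<Rightarrow> 'c"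
      where "g = (\<lambda>(x, y). case x of Mult p \<Rightarrow> case y of Mult q \<Rightarrow> Poly_Mapping.lookup p 0 * Poly_Mapping.lookup q 0)"
    have pair: "k.lin_extend g (pair p q) = Poly_Mapping.lookup p 0 * Poly_Mapping.lookup q 0" for p q
      by (simp add: pair_def monom_def g_def)
    have rels: "k.lin_extend g r = 0" if "r \<in> bilin_rels" for r
      using that unfolding bilin_rels_def
      by (auto simp: k.lin_extend_diff k.lin_extend_scale pair lookup_add distrib_left distrib_right
          mult.assoc mult.left_commute simp del: k.scale_scale)
    have null: "k.lin_extend g r = 0" if "r \<in> bilin_null" for r
      using that unfolding bilin_null_def
      by (induction rule: fin_fun.span_induct_alt)
        (simp_all add: rels k.lin_extend_add k.lin_extend_scale)
    have "k.lin_extend g (0 - 1) \<noteq> 0"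
      by (simp only: k.lin_extend_diff k.lin_extend_zero one_free_pairs pair) (simp add: lookup_one)
    then show "\<not> (0 :: ('a, 'b, 'c) free_pairs) - 1 \<in> bilin_null"
      using null by blast
  qed
qed

end

lemma tensor_of_mult: "(p \<otimes> q) * (p' \<otimes> q') = (p * p') \<otimes> (q * q')"
  by (simp add: tensor_of.abs_eq times_tensor.abs_eq pair_mult)

lemma one_tensor_eq: "1 = 1 \<otimes> 1"
  by (simp only: tensor_of.abs_eq one_tensor.abs_eq one_free_pairs)

lemma tensor_scale_mult_left: "tensor_scale c s * t = tensor_scale c (s * t)"
  by transfer (simp add: bilin_null_def fin_fun.span_zero scale_mult_left)

lemma tensor_scale_mult_right: "s * tensor_scale c t = tensor_scale c (s * t)"
  by transfer (simp add: bilin_null_def fin_fun.span_zero scale_mult_right)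

text \<open>
  For subspaces \<open>U\<close> and \<open>V\<close>, this is the image of \<open>U \<otimes> V\<close> in the tensor product of the ambient
  algebras; as \<open>'k\<close> is a field, \<open>U \<otimes> V\<close> embeds as this image.
\<close>

definition tensor_sub ::
  "('a \<Rightarrow>\<^sub>0 'k) set \<Rightarrow> ('b \<Rightarrow>\<^sub>0 'k) set \<Rightarrow> ('a, 'b, 'k::field) tensor set"
  where "tensor_sub U V = tensor.span {u \<otimes> v | u v. u \<in> U \<and> v \<in> V}"


section \<open>The coproduct\<close>

type_synonym ('n, 'k) mpoly_tensor = "('n \<Rightarrow>\<^sub>0 nat, 'n \<Rightarrow>\<^sub>0 nat, 'k) tensor"

definition algebra_hom :: "(('n, 'k::field) mpoly \<Rightarrow> ('n, 'k) mpoly_tensor) \<Rightarrow> bool"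
  where "algebra_hom \<Delta> \<longleftrightarrow> Vector_Spaces.linear scale tensor_scale \<Delta> \<and>
    \<Delta> 1 = 1 \<and> (\<forall>p q. \<Delta> (p * q) = \<Delta> p * \<Delta> q)"

definition coideal :: "(('n, 'k::field) mpoly \<Rightarrow> ('n, 'k) mpoly_tensor) \<Rightarrow> ('n, 'k) mpoly set \<Rightarrow> bool"
  where "coideal \<Delta> I \<longleftrightarrow> \<Delta> ` I \<subseteq> tensor_sub UNIV I + tensor_sub I UNIV"

text \<open>There is exactly one coproduct with \<open>\<Delta> x\<^sub>i = x\<^sub>i \<otimes> x\<^sub>i\<close>.\<close>

lemma monom_induct [case_names one var_mult]:
  fixes P :: "('n \<Rightarrow>\<^sub>0 nat) \<Rightarrow> bool"
  assumes "P 0" and "\<And>i a. P a \<Longrightarrow> P (Poly_Mapping.single i 1 + a)"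
  shows "P a"
proof -
  have single: "P (Poly_Mapping.single i m + b)" if "P b" for i m b
  proof (induction m)
    case (Suc m)
    then show ?case
      using assms(2)[of "Poly_Mapping.single i m + b" i]
      by (simp add: single_add[symmetric] add.assoc[symmetric])
  qed (simp add: that)
  have "P (\<Sum>i\<in>A. Poly_Mapping.single i (Poly_Mapping.lookup a i))" if "finite A" for A
    using that by induction (simp_all add: assms(1) single)
  from this[of "Poly_Mapping.keys a"] show ?thesis by (simp add: sum_single_lookup)
qed

lemma ex1_coproduct:
  "\<exists>!\<Delta> :: ('n, 'k::field) mpoly \<Rightarrow> ('n, 'k) mpoly_tensor.
    algebra_hom \<Delta> \<and> (\<forall>i. \<Delta> (var i) = var i \<otimes> var i)"
proof (rule ex_ex1I)
  define \<Delta> :: "('n, 'k) mpoly \<Rightarrow> ('n, 'k) mpoly_tensor"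
    where "\<Delta> = tensor.lin_extend (\<lambda>a. monom a \<otimes> monom a)"
  have lin: "Vector_Spaces.linear scale tensor_scale \<Delta>"
    by unfold_locales (simp_all add: \<Delta>_def tensor.lin_extend_add tensor.lin_extend_scale)
  have monom: "\<Delta> (monom a) = monom a \<otimes> monom a" for a
    by (simp add: \<Delta>_def monom_def)
  have monom_mult: "monom a * monom b = (monom (a + b) :: ('n, 'k) mpoly)" for a b
    by (simp add: monom_def mult_single)
  interpret \<Delta>: Vector_Spaces.linear scale tensor_scale \<Delta> by (fact lin)
  have mult: "\<Delta> (p * q) = \<Delta> p * \<Delta> q" for p q
  proof -
    have "\<Delta> ((\<Sum>a\<in>Poly_Mapping.keys p. scale (Poly_Mapping.lookup p a) (monom a)) * (\<Sum>b\<in>Poly_Mapping.keys q. scale (Poly_Mapping.lookup q b) (monom b)))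
      = \<Delta> (\<Sum>a\<in>Poly_Mapping.keys p. scale (Poly_Mapping.lookup p a) (monom a)) * \<Delta> (\<Sum>b\<in>Poly_Mapping.keys q. scale (Poly_Mapping.lookup q b) (monom b))"
      by (simp add: sum_product \<Delta>.sum \<Delta>.scale scale_mult_left scale_mult_right monom monom_mult
          tensor_scale_mult_left tensor_scale_mult_right tensor_of_mult)
    then show ?thesis by (simp only: sum_scale_monom)
  qed
  have one: "\<Delta> 1 = 1"
    using monom[of 0] by (simp add: monom_def one_tensor_eq)
  show "\<exists>\<Delta> :: ('n, 'k) mpoly \<Rightarrow> ('n, 'k) mpoly_tensor.
      algebra_hom \<Delta> \<and> (\<forall>i. \<Delta> (var i) = var i \<otimes> var i)"
    using lin mult one monom unfolding algebra_hom_def var_def by blast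
next
  fix \<Delta> \<Delta>' :: "('n, 'k) mpoly \<Rightarrow> ('n, 'k) mpoly_tensor"
  assume \<Delta>: "algebra_hom \<Delta> \<and> (\<forall>i. \<Delta> (var i) = var i \<otimes> var i)"
    and \<Delta>': "algebra_hom \<Delta>' \<and> (\<forall>i. \<Delta>' (var i) = var i \<otimes> var i)"
  interpret \<Delta>: Vector_Spaces.linear scale tensor_scale \<Delta>
    using \<Delta> by (simp add: algebra_hom_def)
  interpret \<Delta>': Vector_Spaces.linear scale tensor_scale \<Delta>'
    using \<Delta>' by (simp add: algebra_hom_def)
  have monom: "\<Delta> (monom a) = \<Delta>' (monom a)" for a
  proof (induction a rule: monom_induct)
    case one
    show ?case using \<Delta> \<Delta>' by (simp add: monom_def algebra_hom_def)
  next
    case (var_mult i a)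
    have "monom (Poly_Mapping.single i 1 + a) = var i * (monom a :: ('n, 'k) mpoly)"
      by (simp add: monom_def var_def mult_single)
    then show ?case using \<Delta> \<Delta>' var_mult by (simp add: algebra_hom_def)
  qed
  have "\<Delta> (\<Sum>a\<in>Poly_Mapping.keys p. scale (Poly_Mapping.lookup p a) (monom a)) = \<Delta>' (\<Sum>a\<in>Poly_Mapping.keys p. scale (Poly_Mapping.lookup p a) (monom a))"
    for p
    by (simp add: \<Delta>.sum \<Delta>'.sum \<Delta>.scale \<Delta>'.scale monom)
  then show "\<Delta> = \<Delta>'" by (simp add: sum_scale_monom fun_eq_iff)
qed

end

theory Submission
  imports Defs
begin

text \<open>
  The coproduct satisfies \<open>\<Delta> x\<^sup>a = x\<^sup>a \<otimes> x\<^sup>a\<close>: monomials are grouplike. If \<open>I\<close> is a coideal, the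
  quotient by \<open>I\<close> is a coalgebra spanned by the grouplike residues of the monomials. Distinct
  grouplike elements of a coalgebra are linearly independent, so the only linear relations between
  residues of monomials are the obvious ones: some residues vanish and some coincide. These are the
  relations given by the monomials and the differences of monomials in \<open>I\<close>. Conversely,
  \<open>x\<^sup>a \<otimes> x\<^sup>a - x\<^sup>b \<otimes> x\<^sup>b = x\<^sup>a \<otimes> (x\<^sup>a - x\<^sup>b) + (x\<^sup>a - x\<^sup>b) \<otimes> x\<^sup>b\<close>.

  The independence argument is carried out without the quotient. For a linear functional \<open>\<phi>\<close> that
  vanishes on \<open>I\<close>, the map \<open>\<phi> \<otimes> id\<close> sends \<open>k[x] \<otimes> I + I \<otimes> k[x]\<close> into \<open>I\<close> and \<open>\<Delta> f\<close> to the polynomial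
  obtained from \<open>f\<close> by multiplying the coefficient of each \<open>x\<^sup>a\<close> by \<open>\<phi> x\<^sup>a\<close>. Hence \<open>I\<close> is closed under
  this reweighting of coefficients (\<open>coideal_reweight\<close>). If \<open>x\<^sup>a\<close> and \<open>x\<^sup>b\<close> occur in \<open>f \<in> I\<close> and
  differ modulo \<open>I\<close>, some \<open>\<phi>\<close> separates them, and reweighting splits \<open>f\<close> into two elements of \<open>I\<close>
  with fewer terms. An element of \<open>I\<close> that cannot be split has all its monomials congruent
  modulo \<open>I\<close>, and is visibly a combination of binomials in \<open>I\<close> (\<open>reweight_closed_span\<close>).
\<close>

section \<open>Linear functionals and maps out of the tensor product\<close>

lemma linear_sum_monom:
  assumes "Vector_Spaces.linear scale s h"
  shows "h p = (\<Sum>x\<in>Poly_Mapping.keys p. s (Poly_Mapping.lookup p x) (h (monom x)))"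
proof -
  interpret h: Vector_Spaces.linear scale s h by (fact assms)
  have "h (\<Sum>x\<in>Poly_Mapping.keys p. scale (Poly_Mapping.lookup p x) (monom x))
      = (\<Sum>x\<in>Poly_Mapping.keys p. s (Poly_Mapping.lookup p x) (h (monom x)))"
    by (simp add: h.sum h.scale)
  then show ?thesis by (simp add: sum_scale_monom)
qed

lemma vector_space_times: "vector_space ((*) :: 'k::field \<Rightarrow> 'k \<Rightarrow> 'k)"
  by unfold_locales (simp_all add: algebra_simps)

lemma (in vector_space) separating_functional:
  assumes "subspace S" "x \<notin> S"
  obtains \<phi> where "Vector_Spaces.linear scale (*) \<phi>" "\<And>y. y \<in> S \<Longrightarrow> \<phi> y = 0" "\<phi> x = 1"
proof -
  interpret pair: vector_space_pair scale "(*) :: 'a \<Rightarrow> 'a \<Rightarrow> 'a"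
    using vector_space_axioms vector_space_times by (rule vector_space_pair.intro)
  obtain B where B: "B \<subseteq> S" "independent B" "S \<subseteq> span B"
    using maximal_independent_subset[of S] by blast
  have "x \<notin> span B"
    using assms span_minimal[OF B(1)] by blast
  then have indep: "independent (insert x B)"
    using B(2) by (simp add: independent_insert)
  obtain \<phi> where \<phi>: "Vector_Spaces.linear scale (*) \<phi>"
    "\<forall>y\<in>insert x B. \<phi> y = (if y = x then 1 else 0)"
    using pair.linear_independent_extend[OF indep, of "\<lambda>y. if y = x then 1 else 0"] by blast
  have "\<phi> y = 0" if "y \<in> S" for y
  proof (rule pair.linear_eq_0_on_span[OF \<phi>(1), of B])
    show "\<phi> b = 0" if "b \<in> B" for b
      using that \<phi>(2) \<open>x \<notin> span B\<close> span_base by fastforce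
  qed (use that B in blast)
  with \<phi> show thesis by (intro that[of \<phi>]) auto
qed

text \<open>
  The universal property of the tensor product. On the free vector space of pairs, the linear
  extension of \<open>\<beta>\<close> kills the bilinearity relations, so its value at a representative of a tensor
  does not depend on the representative.
\<close>

lemma (in vector_space) tensor_lift:
  fixes \<beta> :: "('x \<Rightarrow>\<^sub>0 'a) \<Rightarrow> ('y \<Rightarrow>\<^sub>0 'a) \<Rightarrow> 'b"
  assumes "\<And>p p' q. \<beta> (p + p') q = \<beta> p q + \<beta> p' q"
    and "\<And>p q q'. \<beta> p (q + q') = \<beta> p q + \<beta> p q'"
    and "\<And>c p q. \<beta> (Defs.scale c p) q = c *s \<beta> p q"
    and "\<And>c p q. \<beta> p (Defs.scale c q) = c *s \<beta> p q"
  obtains L where "Vector_Spaces.linear tensor_scale scale L" "\<And>p q. L (p \<otimes> q) = \<beta> p q"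
proof -
  define h :: "('x, 'y, 'a) free_pairs \<Rightarrow> 'b"
    where "h = lin_extend (\<lambda>(x, y). case x of Mult p \<Rightarrow> case y of Mult q \<Rightarrow> \<beta> p q)"
  have h_pair: "h (pair p q) = \<beta> p q" for p q
    by (simp add: h_def pair_def monom_def)
  have h_add: "h (s + t) = h s + h t" and h_diff: "h (s - t) = h s - h t"
    and h_scale: "h (Defs.scale c s) = c *s h s" for s t c
    by (simp_all add: h_def lin_extend_add lin_extend_diff lin_extend_scale)
  have h_zero: "h 0 = 0"
    by (simp add: h_def)
  have rels: "h r = 0" if "r \<in> bilin_rels" for r
    using that unfolding bilin_rels_def
    by (auto simp: h_diff h_scale h_pair assms)
  have null: "h r = 0" if "r \<in> bilin_null" for r
    using that unfolding bilin_null_def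
    by (induction rule: fin_fun.span_induct_alt) (simp_all add: rels h_add h_scale h_zero)
  define L where "L t = h (rep_tensor t)" for t
  have L_abs: "L (abs_tensor s) = h s" for s
  proof -
    have "rep_tensor (abs_tensor s) - s \<in> bilin_null"
      using Quotient_rep_abs[OF Quotient_tensor, of s]
      by (simp add: bilin_null_def fin_fun.span_zero)
    then have "h (rep_tensor (abs_tensor s) - s) = 0"
      by (rule null)
    then show ?thesis by (simp add: L_def h_diff)
  qed
  have add: "L (s + t) = L s + L t" for s t
    by (induction s; induction t) (simp add: plus_tensor.abs_eq L_abs h_add)
  have scale: "L (tensor_scale c s) = c *s L s" for c s
    by (induction s) (simp add: tensor_scale.abs_eq L_abs h_scale)
  have "Vector_Spaces.linear tensor_scale scale L"
    by (intro Vector_Spaces.linear.intro module_hom.intro module_hom_axioms.intro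
        tensor.vector_space_axioms vector_space_axioms tensor.module_axioms module_axioms add scale)
  moreover have "L (p \<otimes> q) = \<beta> p q" for p q
    by (simp add: tensor_of.abs_eq L_abs h_pair)
  ultimately show thesis by (rule that)
qed


section \<open>Unital ideals as spans of binomials\<close>

definition unital_binomials :: "('m \<Rightarrow>\<^sub>0 'k::field) set"
  where "unital_binomials = {monom a - scale c (monom b) | a b c. c \<in> {0, 1}}"

lemma monom_unital_binomial: "monom a \<in> unital_binomials"
  unfolding unital_binomials_def
  by (rule CollectI, rule exI[of _ a], rule exI[of _ a], rule exI[of _ 0]) simp

lemma diff_unital_binomial: "monom a - monom b \<in> unital_binomials"
  unfolding unital_binomials_def
  by (rule CollectI, rule exI[of _ a], rule exI[of _ b], rule exI[of _ 1]) simp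

lemma unital_binomials_cases:
  assumes "g \<in> unital_binomials"
  obtains (monom) a where "g = monom a" | (diff) a b where "g = monom a - monom b"
  using assms unfolding unital_binomials_def by auto

lemma monom_mult: "monom a * monom b = (monom (a + b) :: 'm::comm_monoid_add \<Rightarrow>\<^sub>0 'k::field)"
  by (simp add: monom_def mult_single)

lemma monom_mult_unital_binomial:
  fixes m :: "'m::comm_monoid_add"
  assumes "g \<in> unital_binomials"
  shows "monom m * g \<in> unital_binomials"
  using assms
  by (cases rule: unital_binomials_cases)
    (simp_all add: right_diff_distrib monom_mult monom_unital_binomial diff_unital_binomial)

lemma is_ideal_subspace:
  fixes I :: "('m::comm_monoid_add \<Rightarrow>\<^sub>0 'k::field) set"
  assumes "is_ideal I"
  shows "fin_fun.subspace I"
  using assms by (auto simp: is_ideal_iff fin_fun.subspace_def scale_eq_mult)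

text \<open>
  Multiplying a binomial by a monomial gives a binomial, so the linear span of the binomials in an
  ideal is itself an ideal.
\<close>

lemma is_ideal_span_unital_binomials:
  fixes I :: "('m::comm_monoid_add \<Rightarrow>\<^sub>0 'k::field) set"
  assumes "is_ideal I"
  shows "is_ideal (fin_fun.span (I \<inter> unital_binomials))" (is "is_ideal ?J")
proof -
  have monom: "monom m * x \<in> ?J" if "x \<in> ?J" for m x
    using that
  proof (induction rule: fin_fun.span_induct_alt)
    case base
    show ?case by (simp add: fin_fun.span_zero)
  next
    case (step c g x)
    then have "monom m * g \<in> I \<inter> unital_binomials"
      using assms by (simp add: is_ideal_iff monom_mult_unital_binomial)
    with step show ?case
      by (simp add: distrib_left scale_mult_right fin_fun.span_add fin_fun.span_scale fin_fun.span_base)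
  qed
  have "r * x \<in> ?J" if "x \<in> ?J" for r x
  proof -
    have "(\<Sum>m\<in>Poly_Mapping.keys r. scale (Poly_Mapping.lookup r m) (monom m)) * x \<in> ?J"
      unfolding sum_distrib_right scale_mult_left
      by (intro fin_fun.span_sum fin_fun.span_scale monom that)
    then show ?thesis by (simp add: sum_scale_monom)
  qed
  then show ?thesis by (simp add: is_ideal_iff fin_fun.span_zero fin_fun.span_add)
qed

text \<open>
  This replaces generation as an ideal by generation as a vector space. The coideal condition is
  linear too, so that both conditions can be compared on linear combinations of monomials.
\<close>

lemma unital_iff_span:
  fixes I :: "('n, 'k::field) mpoly set"
  assumes I: "is_ideal I"
  shows "unital I \<longleftrightarrow> I \<subseteq> fin_fun.span (I \<inter> unital_binomials)" (is "_ \<longleftrightarrow> I \<subseteq> ?J")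
proof
  assume "unital I"
  then obtain G where G: "G \<subseteq> unital_binomials" "I = ideal_generated G"
    by (auto simp: unital_def unital_binomials_def)
  then have "G \<subseteq> I"
    by (auto simp: ideal_generated_eq)
  with G have "G \<subseteq> ?J"
    using fin_fun.span_superset by fastforce
  with is_ideal_span_unital_binomials[OF I] show "I \<subseteq> ?J"
    unfolding G(2) by (subst (1) ideal_generated_eq) (use G(2) in auto)
next
  assume sub: "I \<subseteq> ?J"
  have "K \<supseteq> I" if "is_ideal K" "I \<inter> unital_binomials \<subseteq> K" for K
    using sub fin_fun.span_minimal[OF that(2) is_ideal_subspace[OF that(1)]] by blast
  then have "I = ideal_generated (I \<inter> unital_binomials)"
    using I by (auto simp: ideal_generated_eq)
  then show "unital I"
    unfolding unital_def unital_binomials_def[symmetric] by blast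
qed


section \<open>Coideals and reweighting of coefficients\<close>

lemma coproduct_monom:
  fixes \<Delta> :: "('n, 'k::field) mpoly \<Rightarrow> ('n, 'k) mpoly_tensor"
  assumes "algebra_hom \<Delta>" and "\<And>i. \<Delta> (var i) = var i \<otimes> var i"
  shows "\<Delta> (monom a) = monom a \<otimes> monom a"
proof (induction a rule: monom_induct)
  case one
  show ?case using assms(1) by (simp add: monom_def algebra_hom_def one_tensor_eq)
next
  case (var_mult i a)
  have "monom (Poly_Mapping.single i 1 + a) = var i * (monom a :: ('n, 'k) mpoly)"
    by (simp add: var_def monom_mult)
  then show ?case
    using assms var_mult by (simp add: algebra_hom_def tensor_of_mult)
qed

lemma coideal_if_subset_span_unital_binomials:
  fixes \<Delta> :: "('n, 'k::field) mpoly \<Rightarrow> ('n, 'k) mpoly_tensor"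
  assumes lin: "Vector_Spaces.linear scale tensor_scale \<Delta>"
    and \<Delta>: "\<And>a. \<Delta> (monom a) = monom a \<otimes> monom a"
    and sub: "I \<subseteq> fin_fun.span (I \<inter> unital_binomials)"
  shows "coideal \<Delta> I"
proof -
  interpret \<Delta>: Vector_Spaces.linear scale tensor_scale \<Delta> by (fact lin)
  let ?T = "tensor_sub UNIV I + tensor_sub I UNIV"
  have subspace: "tensor.subspace ?T"
  proof -
    have "?T = {x + y | x y. x \<in> tensor_sub UNIV I \<and> y \<in> tensor_sub I UNIV}"
      by (auto simp: set_plus_def)
    then show ?thesis
      by (simp add: tensor_sub_def tensor.subspace_sums)
  qed
  have left: "p \<otimes> u \<in> tensor_sub UNIV I" and right: "u \<otimes> p \<in> tensor_sub I UNIV"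
    if "u \<in> I" for p u
    using that by (auto simp: tensor_sub_def intro!: tensor.span_base)
  have zero: "0 \<in> tensor_sub U V" for U V :: "('n, 'k) mpoly set"
    by (simp add: tensor_sub_def tensor.span_zero)
  have binomial: "\<Delta> g \<in> ?T" if "g \<in> I \<inter> unital_binomials" for g
  proof -
    from that have "g \<in> I" "g \<in> unital_binomials" by auto
    from this(2) show ?thesis
    proof (cases rule: unital_binomials_cases)
      case (monom a)
      then show ?thesis
        using set_plus_intro[OF left[OF \<open>g \<in> I\<close>, of g] zero] by (simp add: \<Delta>)
    next
      case (diff a b)
      \<comment> \<open>the Leibniz rule for the difference of two grouplike elements\<close>
      have eq: "\<Delta> g = monom a \<otimes> g + g \<otimes> monom b"
      proof -
        have "monom a \<otimes> (monom b + g) = monom a \<otimes> monom b + monom a \<otimes> g"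
          "(monom b + g) \<otimes> monom b = monom b \<otimes> monom b + g \<otimes> monom b"
          by (rule tensor_of_add_right, rule tensor_of_add_left)
        moreover have "monom b + g = monom a" by (simp add: diff)
        moreover have "\<Delta> g = monom a \<otimes> monom a - monom b \<otimes> monom b"
          by (simp add: diff \<Delta>.diff \<Delta>)
        ultimately show ?thesis by simp
      qed
      show ?thesis
        unfolding eq by (intro set_plus_intro left right \<open>g \<in> I\<close>)
    qed
  qed
  have "\<Delta> f \<in> ?T" if "f \<in> fin_fun.span (I \<inter> unital_binomials)" for f
    using that
  proof (induction rule: fin_fun.span_induct_alt)
    case base
    show ?case by (simp add: \<Delta>.zero tensor.subspace_0[OF subspace])
  next
    case (step c g f)
    then show ?case
      using binomial
      by (simp add: \<Delta>.add \<Delta>.scale tensor.subspace_add[OF subspace] tensor.subspace_scale[OF subspace])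
  qed
  with sub show ?thesis by (auto simp: coideal_def)
qed

text \<open>
  The element \<open>g\<close> is the image of \<open>\<Delta> f\<close> under \<open>\<phi> \<otimes> id\<close>. That map kills \<open>I \<otimes> k[x]\<close> and sends
  \<open>k[x] \<otimes> I\<close> into \<open>I\<close>.
\<close>

lemma coideal_reweight:
  fixes \<Delta> :: "('n, 'k::field) mpoly \<Rightarrow> ('n, 'k) mpoly_tensor"
  assumes lin: "Vector_Spaces.linear scale tensor_scale \<Delta>"
    and \<Delta>: "\<And>a. \<Delta> (monom a) = monom a \<otimes> monom a"
    and I: "fin_fun.subspace I" and coideal: "coideal \<Delta> I"
    and \<phi>: "Vector_Spaces.linear scale (*) \<phi>" "\<And>p. p \<in> I \<Longrightarrow> \<phi> p = 0"
    and f: "f \<in> I"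
  shows "\<exists>g\<in>I. \<forall>a. Poly_Mapping.lookup g a = \<phi> (monom a) * Poly_Mapping.lookup f a"
proof -
  interpret \<phi>: Vector_Spaces.linear scale "(*)" \<phi> by (fact \<phi>(1))
  obtain L :: "('n, 'k) mpoly_tensor \<Rightarrow> ('n, 'k) mpoly"
    where L: "Vector_Spaces.linear tensor_scale scale L" and L_tensor: "\<And>p q. L (p \<otimes> q) = scale (\<phi> p) q"
    by (rule fin_fun.tensor_lift[of "\<lambda>p q. scale (\<phi> p) q", OF _ _ _ _ that])
      (simp_all add: \<phi>.add \<phi>.scale fin_fun.scale_left_distrib fin_fun.scale_right_distrib mult.commute)
  interpret L: Vector_Spaces.linear tensor_scale scale L by (fact L)
  have span: "L t \<in> I" if "t \<in> tensor.span X" "\<And>x. x \<in> X \<Longrightarrow> L x \<in> I" for t X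
    using that(1)
    by (induction rule: tensor.span_induct_alt)
      (simp_all add: L.zero L.add L.scale that(2) fin_fun.subspace_0[OF I] fin_fun.subspace_add[OF I]
        fin_fun.subspace_scale[OF I])
  have "L t \<in> I" if "t \<in> tensor_sub UNIV I" for t
    using that unfolding tensor_sub_def
    by (rule span) (auto simp: L_tensor fin_fun.subspace_scale[OF I])
  moreover have "L t \<in> I" if "t \<in> tensor_sub I UNIV" for t
    using that unfolding tensor_sub_def
    by (rule span) (auto simp: L_tensor \<phi>(2) fin_fun.subspace_0[OF I])
  moreover have "\<Delta> f \<in> tensor_sub UNIV I + tensor_sub I UNIV"
    using coideal f by (auto simp: coideal_def)
  ultimately have "L (\<Delta> f) \<in> I"
    by (auto simp: set_plus_def L.add fin_fun.subspace_add[OF I])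
  moreover have "Poly_Mapping.lookup (L (\<Delta> f)) a = \<phi> (monom a) * Poly_Mapping.lookup f a" for a
  proof -
    have "L (\<Delta> f) = (\<Sum>b\<in>Poly_Mapping.keys f. scale (Poly_Mapping.lookup f b * \<phi> (monom b)) (monom b))"
      by (subst linear_sum_monom[OF lin]) (simp add: L.sum L.scale \<Delta> L_tensor)
    then show ?thesis
      by (simp add: lookup_sum monom_def lookup_single when_def if_distrib sum.delta in_keys_iff
          mult.commute cong: if_cong)
  qed
  ultimately show ?thesis by blast
qed

text \<open>
  This is the linear independence of distinct grouplike elements. Suppose that \<open>monom a\<close> and
  \<open>monom b\<close> occur in \<open>f\<close> and that \<open>\<phi>\<close> takes the value \<open>1\<close> on their difference. If \<open>g\<close> is \<open>f\<close>
  reweighted by \<open>\<phi>\<close>, then \<open>h = g - \<phi> (monom b) f\<close> is \<open>f\<close> reweighted by \<open>\<phi> - \<phi> (monom b)\<close>. This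
  weight is \<open>0\<close> at \<open>b\<close> and \<open>1\<close> at \<open>a\<close>, so \<open>h\<close> has no term at \<open>b\<close> and \<open>f - h\<close> has none at \<open>a\<close>.
\<close>

lemma reweight_closed_span:
  fixes I :: "('m \<Rightarrow>\<^sub>0 'k::field) set"
  assumes I: "fin_fun.subspace I"
    and reweight: "\<And>\<phi> f. Vector_Spaces.linear scale (*) \<phi> \<Longrightarrow> (\<And>p. p \<in> I \<Longrightarrow> \<phi> p = 0) \<Longrightarrow> f \<in> I \<Longrightarrow>
      \<exists>g\<in>I. \<forall>a. Poly_Mapping.lookup g a = \<phi> (monom a) * Poly_Mapping.lookup f a"
    and "f \<in> I"
  shows "f \<in> fin_fun.span (I \<inter> unital_binomials)" (is "f \<in> ?J")
  using \<open>f \<in> I\<close>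
proof (induction "card (Poly_Mapping.keys f)" arbitrary: f rule: less_induct)
  case less
  have smaller: "g \<in> ?J"
    if "g \<in> I" "Poly_Mapping.keys g \<subseteq> Poly_Mapping.keys f" "a \<in> Poly_Mapping.keys f" "a \<notin> Poly_Mapping.keys g" for a g
    using that by (intro less.hyps psubset_card_mono) auto
  show ?case
  proof (cases "f = 0")
    case True
    then show ?thesis by (simp add: fin_fun.span_zero)
  next
    case False
    then obtain b where b: "b \<in> Poly_Mapping.keys f"
      by (metis keys_eq_empty ex_in_conv)
    show ?thesis
    proof (cases "\<exists>a\<in>Poly_Mapping.keys f. monom a - monom b \<notin> I")
      case True
      then obtain a where a: "a \<in> Poly_Mapping.keys f" "monom a - monom b \<notin> I" by blast
      obtain \<phi> where \<phi>: "Vector_Spaces.linear scale (*) \<phi>" "\<And>p. p \<in> I \<Longrightarrow> \<phi> p = 0"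
        "\<phi> (monom a - monom b) = 1"
        using fin_fun.separating_functional[OF I a(2)] by blast
      interpret \<phi>: Vector_Spaces.linear scale "(*)" \<phi> by (fact \<phi>(1))
      have ab: "\<phi> (monom a) = \<phi> (monom b) + 1"
        using \<phi>(3) by (simp add: \<phi>.diff algebra_simps)
      obtain g where g: "g \<in> I" "\<And>m. Poly_Mapping.lookup g m = \<phi> (monom m) * Poly_Mapping.lookup f m"
        using reweight[OF \<phi>(1,2) less.prems] by blast
      define h where "h = g - scale (\<phi> (monom b)) f"
      have h: "Poly_Mapping.lookup h m = (\<phi> (monom m) - \<phi> (monom b)) * Poly_Mapping.lookup f m" for m
        by (simp add: h_def lookup_minus g(2) left_diff_distrib)
      have "h \<in> I"
        using I g(1) less.prems by (simp add: h_def fin_fun.subspace_diff fin_fun.subspace_scale)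
      moreover from this have "f - h \<in> I"
        using I less.prems by (simp add: fin_fun.subspace_diff)
      ultimately have "h \<in> ?J" "f - h \<in> ?J"
        using a(1) b
        by (auto intro!: smaller[of h b] smaller[of "f - h" a] simp: in_keys_iff h lookup_minus ab)
      then have "h + (f - h) \<in> ?J" by (rule fin_fun.span_add)
      then show ?thesis by simp
    next
      case False
      \<comment> \<open>All monomials of \<open>f\<close> are congruent to \<open>monom b\<close>: replacing each by \<open>monom b\<close> costs the
        combination \<open>r\<close> of differences in \<open>I\<close> and leaves a multiple of \<open>monom b\<close> that lies in \<open>I\<close>.\<close>
      define c where "c = (\<Sum>a\<in>Poly_Mapping.keys f. Poly_Mapping.lookup f a)"
      define r where "r = (\<Sum>a\<in>Poly_Mapping.keys f. scale (Poly_Mapping.lookup f a) (monom a - monom b))"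
      have "r = (\<Sum>a\<in>Poly_Mapping.keys f. scale (Poly_Mapping.lookup f a) (monom a)) - scale c (monom b)"
        by (simp only: r_def c_def fin_fun.scale_right_diff_distrib sum_subtractf fin_fun.scale_sum_left)
      then have f: "f = r + scale c (monom b)"
        by (simp add: sum_scale_monom)
      have r: "r \<in> ?J"
        unfolding r_def using False
        by (intro fin_fun.span_sum fin_fun.span_scale fin_fun.span_base) (auto simp: diff_unital_binomial)
      have "?J \<subseteq> I"
        by (rule fin_fun.span_minimal[OF _ I]) simp
      then have "f - r \<in> I"
        using less.prems r by (intro fin_fun.subspace_diff[OF I]) auto
      then have cb: "scale c (monom b) \<in> I"
        by (subst (asm) f) simp
      have "scale c (monom b) \<in> ?J"
      proof (cases "c = 0")
        case True
        then show ?thesis by (simp add: fin_fun.span_zero)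
      next
        case False
        then have "monom b \<in> I"
          using fin_fun.subspace_scale[OF I cb, of "inverse c"] by simp
        then show ?thesis
          by (intro fin_fun.span_scale fin_fun.span_base) (simp add: monom_unital_binomial)
      qed
      with r show ?thesis
        by (subst f) (rule fin_fun.span_add)
    qed
  qed
qed


section \<open>Unital ideals are the coideals\<close>

theorem proposition4p4:
  fixes I :: "('n::finite, 'k::field) mpoly set"
    and \<Delta> :: "('n, 'k) mpoly \<Rightarrow> ('n, 'k) mpoly_tensor"
  assumes "algebra_hom \<Delta>"
    and "\<And>i. \<Delta> (var i) = var i \<otimes> var i"
    and "is_ideal I"
  shows "unital I \<longleftrightarrow> coideal \<Delta> I"
proof -
  have lin: "Vector_Spaces.linear scale tensor_scale \<Delta>"
    using assms(1) by (simp add: algebra_hom_def)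
  have \<Delta>: "\<Delta> (monom a) = monom a \<otimes> monom a" for a
    using assms(1,2) by (rule coproduct_monom)
  have I: "fin_fun.subspace I"
    using assms(3) by (rule is_ideal_subspace)
  have "I \<subseteq> fin_fun.span (I \<inter> unital_binomials)" if "coideal \<Delta> I"
    using reweight_closed_span[OF I coideal_reweight[OF lin \<Delta> I that]] by blast
  then show ?thesis
    using coideal_if_subset_span_unital_binomials[OF lin \<Delta>] unital_iff_span[OF assms(3)] by blast
qed

end
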